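(* Let $n\ge 2$ and let $\diamondsuit:\mathcal{K}^n\to\mathcal{K}^n_s$ be a map (an $o$-symmetrization of compact convex sets). Then $\diamondsuit$ is continuous in the Hausdorff metric, $GL(n)$ covariant, and translation invariant if and only if there is a $\lambda\ge 0$ such that $\diamondsuit K=\lambda DK$ for all $K\in\mathcal{K}^n$, where $DK=K+(-K)$ is the difference body of $K$.
   Context: $\mathcal{K}^n$ is the class of nonempty compact convex subsets of $\mathbb{R}^n$ and $\mathcal{K}^n_s$ the subclass of $o$-symmetric sets ($K=-K$). $K+L=\{x+y:x\in K,y\in L\}$ is the Minkowski sum. Properties of $\diamondsuit$: continuous: $K_m\to K$ in the Hausdorff metric implies $\diamondsuit K_m\to\diamondsuit K$ in the Hausdorff metric; $GL(n)$ covariant: $\phi(\diamondsuit K)=\diamondsuit(\phi K)$ for all $\phi\in GL(n)$ and $K\in\mathcal{K}^n$; translation invariant: $\diamondsuit(K+z)=\diamondsuit K$ for all $K\in\mathcal{K}^n$ and $z\in\mathbb{R}^n$. *)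

theory Defs
  imports "HOL-Analysis.Analysis"
begin

text \<open>
  Pitfall: on sets, unary minus is the complement, so the reflection of \<open>K\<close> in the origin is
  \<open>uminus ` K\<close>. Addition of sets is the Minkowski sum of \<open>Set_Algebras\<close>.
\<close>

definition compact_convex_sets :: "'a::euclidean_space set set" where
  "compact_convex_sets = {K. K \<noteq> {} \<and> compact K \<and> convex K}"

definition o_symmetric :: "'a::euclidean_space set \<Rightarrow> bool" where
  "o_symmetric K \<longleftrightarrow> K = uminus ` K"

definition symmetric_compact_convex_sets :: "'a::euclidean_space set set" where
  "symmetric_compact_convex_sets = {K \<in> compact_convex_sets. o_symmetric K}"

text \<open>The suprema are meaningful because this is only applied to nonempty compact sets.\<close>

definition hausdorff_dist :: "'a::euclidean_space set \<Rightarrow> 'a set \<Rightarrow> real" where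
  "hausdorff_dist K L = max (SUP x\<in>K. infdist x L) (SUP y\<in>L. infdist y K)"

definition difference_body :: "'a::euclidean_space set \<Rightarrow> 'a set" where
  "difference_body K = K + uminus ` K"

text \<open>
  A map defined on the class of nonempty compact convex sets is represented by a total function
  on sets; all properties below only concern its values on that class.
\<close>

definition hausdorff_continuous :: "('a::euclidean_space set \<Rightarrow> 'a set) \<Rightarrow> bool" where
  "hausdorff_continuous F \<longleftrightarrow>
    (\<forall>(Ks :: nat \<Rightarrow> 'a set) K.
      (\<forall>m. Ks m \<in> compact_convex_sets) \<longrightarrow> K \<in> compact_convex_sets \<longrightarrow>
      (\<lambda>m. hausdorff_dist (Ks m) K) \<longlonglongrightarrow> 0 \<longrightarrow>
      (\<lambda>m. hausdorff_dist (F (Ks m)) (F K)) \<longlonglongrightarrow> 0)"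

definition GL_covariant :: "((real ^ 'n) set \<Rightarrow> (real ^ 'n) set) \<Rightarrow> bool" where
  "GL_covariant F \<longleftrightarrow>
    (\<forall>A :: real ^ 'n ^ 'n. invertible A \<longrightarrow>
      (\<forall>K \<in> compact_convex_sets. (\<lambda>x. A *v x) ` F K = F ((\<lambda>x. A *v x) ` K)))"

definition translation_invariant :: "('a::euclidean_space set \<Rightarrow> 'a set) \<Rightarrow> bool" where
  "translation_invariant F \<longleftrightarrow>
    (\<forall>K \<in> compact_convex_sets. \<forall>z. F ((\<lambda>x. x + z) ` K) = F K)"

end

theory Submission
  imports Defs
begin

text \<open>
  By continuity, covariance under invertible linear maps extends to positive semidefinite ones, such
  as the orthogonal projection \<open>P\<close> onto a line: \<open>P (F K) = F (P K)\<close>. As \<open>P K\<close> is a segment,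
  translation invariance and covariance reduce its image to that of one fixed segment \<open>[0, e]\<close>, which
  the projection onto the span of \<open>e\<close> forces to be of the form \<open>[- l e, l e]\<close>. So \<open>F K\<close> and
  \<open>l D K\<close> have the same projection onto every line, hence coincide.
\<close>

section \<open>The Hausdorff distance\<close>

text \<open>Compactness bounds the suprema, so that they can be compared with \<open>d\<close>, and
  makes the infimum distances attained, so that a nearest point realises the bound without any
  margin. The later estimates work with such nearby points.\<close>

lemma hausdorff_dist_le_iff:
  fixes K L :: "'a::euclidean_space set"
  assumes "compact K" "K \<noteq> {}" "compact L" "L \<noteq> {}"
  shows "hausdorff_dist K L \<le> d \<longleftrightarrow>
    (\<forall>x\<in>K. \<exists>y\<in>L. dist x y \<le> d) \<and> (\<forall>y\<in>L. \<exists>x\<in>K. dist x y \<le> d)"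
proof -
  have bdd: "bdd_above ((\<lambda>x. infdist x B) ` A)" if "compact A" for A B :: "'a set"
    using that by (intro bounded_imp_bdd_above compact_imp_bounded compact_continuous_image
      continuous_intros)
  have inf: "infdist x A \<le> d \<longleftrightarrow> (\<exists>y\<in>A. dist x y \<le> d)" if "compact A" "A \<noteq> {}" for A and x :: 'a
    using infdist_attains_inf[OF compact_imp_closed[OF that(1)] that(2), of x] infdist_le2
    by metis
  show ?thesis
    unfolding hausdorff_dist_def using assms bdd
    by (simp add: cSUP_le_iff inf dist_commute)
qed

lemma hausdorff_dist_commute: "hausdorff_dist K L = hausdorff_dist L K"
  unfolding hausdorff_dist_def by (simp add: max.commute)

lemma hausdorff_dist_nonneg:
  fixes K L :: "'a::euclidean_space set"
  assumes "compact K" "K \<noteq> {}" "compact L" "L \<noteq> {}"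
  shows "0 \<le> hausdorff_dist K L"
proof -
  obtain x y :: 'a where "dist x y \<le> hausdorff_dist K L"
    using iffD1[OF hausdorff_dist_le_iff[OF assms] order_refl] assms(2) by blast
  then show ?thesis using zero_le_dist[of x y] by linarith
qed

lemma hausdorff_dist_triangle:
  fixes K L M :: "'a::euclidean_space set"
  assumes "compact K" "K \<noteq> {}" "compact L" "L \<noteq> {}" "compact M" "M \<noteq> {}"
  shows "hausdorff_dist K M \<le> hausdorff_dist K L + hausdorff_dist L M"
proof -
  let ?a = "hausdorff_dist K L" and ?b = "hausdorff_dist L M"
  have KL: "\<forall>x\<in>K. \<exists>y\<in>L. dist x y \<le> ?a" "\<forall>y\<in>L. \<exists>x\<in>K. dist x y \<le> ?a"
    using hausdorff_dist_le_iff[OF assms(1-4), of ?a] by auto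
  have LM: "\<forall>y\<in>L. \<exists>z\<in>M. dist y z \<le> ?b" "\<forall>z\<in>M. \<exists>y\<in>L. dist y z \<le> ?b"
    using hausdorff_dist_le_iff[OF assms(3-6), of ?b] by auto
  have tri: "dist x z \<le> ?a + ?b" if "dist x y \<le> ?a" "dist y z \<le> ?b" for x y z :: 'a
    using dist_triangle[of x z y] that by linarith
  show ?thesis
    unfolding hausdorff_dist_le_iff[OF assms(1,2,5,6)]
  proof (intro conjI ballI)
    fix x assume "x \<in> K"
    with KL(1) LM(1) obtain y z where "dist x y \<le> ?a" "z \<in> M" "dist y z \<le> ?b" by blast
    with tri show "\<exists>z\<in>M. dist x z \<le> ?a + ?b" by blast
  next
    fix z assume "z \<in> M"
    with KL(2) LM(2) obtain x y where "dist x y \<le> ?a" "x \<in> K" "dist y z \<le> ?b" by blast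
    with tri show "\<exists>x\<in>K. dist x z \<le> ?a + ?b" by blast
  qed
qed

text \<open>At bound 0 the nearby points coincide with the given ones, so each set contains the
  other.\<close>

lemma hausdorff_dist_le_0_imp_eq:
  fixes K L :: "'a::euclidean_space set"
  assumes "compact K" "K \<noteq> {}" "compact L" "L \<noteq> {}" "hausdorff_dist K L \<le> 0"
  shows "K = L"
  using hausdorff_dist_le_iff[OF assms(1-4), of 0] assms(5) by auto

text \<open>The points \<open>f x\<close> and \<open>g x\<close> serve as partners of each other.
  This compares the images of one set under a map and under a perturbation of it.\<close>

lemma hausdorff_dist_image_le:
  fixes K :: "'a set" and f g :: "'a \<Rightarrow> 'b::euclidean_space"
  assumes "compact (f ` K)" "compact (g ` K)" "K \<noteq> {}" "\<And>x. x \<in> K \<Longrightarrow> dist (f x) (g x) \<le> d"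
  shows "hausdorff_dist (f ` K) (g ` K) \<le> d"
  using assms by (subst hausdorff_dist_le_iff) auto

section \<open>Compact convex sets\<close>

lemma compact_convex_sets_linear_image:
  fixes f :: "'a::euclidean_space \<Rightarrow> 'b::euclidean_space"
  assumes "linear f" "K \<in> compact_convex_sets"
  shows "f ` K \<in> compact_convex_sets"
  using assms
  by (simp add: compact_convex_sets_def convex_linear_image compact_continuous_image
      linear_continuous_on linear_conv_bounded_linear)

section \<open>Difference bodies\<close>

lemma difference_body_alt: "difference_body K = {x - y |x y. x \<in> K \<and> y \<in> K}"
proof -
  have "difference_body K = (\<lambda>(x, y). x - y) ` (K \<times> K)"
    unfolding difference_body_def set_plus_image by (force simp: image_iff)
  then show ?thesis by (auto simp: image_iff)
qed

lemma compact_convex_sets_difference_body: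
  assumes "K \<in> compact_convex_sets"
  shows "difference_body K \<in> compact_convex_sets"
proof -
  have "difference_body K = (\<Union>x\<in>K. \<Union>y\<in>K. {x - y})"
    unfolding difference_body_alt by auto
  then show ?thesis
    using assms convex_differences[of K K] compact_differences[of K K]
    unfolding compact_convex_sets_def difference_body_alt by auto
qed

lemma difference_body_linear_image:
  assumes "linear f"
  shows "difference_body (f ` K) = f ` difference_body K"
proof -
  have "f ` difference_body K = {f (x - y) |x y. x \<in> K \<and> y \<in> K}"
    unfolding difference_body_alt by auto
  also have "\<dots> = difference_body (f ` K)"
    unfolding difference_body_alt linear_diff[OF assms] by blast
  finally show ?thesis by simp
qed

lemma difference_body_translation: "difference_body ((\<lambda>x. x + z) ` K) = difference_body K"
proof -
  have "difference_body ((\<lambda>x. x + z) ` K) = {(x + z) - (y + z) |x y. x \<in> K \<and> y \<in> K}"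
    unfolding difference_body_alt by blast
  then show ?thesis by (simp add: difference_body_alt)
qed

lemma difference_body_segment:
  fixes v :: "'a::euclidean_space"
  assumes "a \<le> b"
  shows "difference_body ((\<lambda>t. t *\<^sub>R v) ` {a..b}) = (\<lambda>t. t *\<^sub>R v) ` {-(b - a)..b - a}"
proof -
  have "difference_body {a..b} = {-(b - a)..b - a}"
  proof (intro equalityI subsetI)
    fix t assume "t \<in> {-(b - a)..b - a}"
    \<comment> \<open>The maxima merge two cases: for \<open>t \<ge> 0\<close> the pair is
      \<open>a + t\<close> and \<open>a\<close>, for \<open>t \<le> 0\<close> it is \<open>a\<close>
      and \<open>a - t\<close>.\<close>
    then have "max a (a + t) \<in> {a..b}" "max a (a - t) \<in> {a..b}"
      "t = max a (a + t) - max a (a - t)"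
      using assms by auto
    then show "t \<in> difference_body {a..b}"
      unfolding difference_body_alt by blast
  qed (auto simp: difference_body_alt)
  then show ?thesis
    by (simp add: difference_body_linear_image linear_scaleR_left)
qed

text \<open>In a difference both points can be moved to the other set, each at the cost of one
  Hausdorff distance. Hence scaled difference bodies depend on the set in a Lipschitz way, with
  constant \<open>2 * l\<close>.\<close>

lemma hausdorff_dist_difference_body_le:
  fixes K L :: "'a::euclidean_space set"
  assumes K: "K \<in> compact_convex_sets" and L: "L \<in> compact_convex_sets" and l: "0 \<le> l"
  shows "hausdorff_dist ((\<lambda>x. l *\<^sub>R x) ` difference_body K) ((\<lambda>x. l *\<^sub>R x) ` difference_body L)
    \<le> l * (2 * hausdorff_dist K L)"
proof -
  let ?d = "hausdorff_dist K L"
  have near: "\<exists>q\<in>(\<lambda>x. l *\<^sub>R x) ` difference_body B. dist p q \<le> l * (2 * e)"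
    if "\<forall>x\<in>A. \<exists>y\<in>B. dist x y \<le> e" "p \<in> (\<lambda>x. l *\<^sub>R x) ` difference_body A" for A B e and p :: 'a
  proof -
    from that(2) obtain x y where xy: "x \<in> A" "y \<in> A" "p = l *\<^sub>R (x - y)"
      unfolding difference_body_alt by auto
    with that(1) obtain x' y' where q: "x' \<in> B" "y' \<in> B" "dist x x' \<le> e" "dist y y' \<le> e"
      by meson
    have "dist (x - y) (x' - y') \<le> 2 * e"
      using q norm_triangle_ineq4[of "x - x'" "y - y'"] by (simp add: dist_norm algebra_simps)
    then have "dist p (l *\<^sub>R (x' - y')) \<le> l * (2 * e)"
      using l xy(3) by (simp add: dist_norm mult_left_mono flip: scaleR_diff_right)
    with q show ?thesis unfolding difference_body_alt by blast
  qed
  have "(\<forall>x\<in>K. \<exists>y\<in>L. dist x y \<le> ?d)" "(\<forall>y\<in>L. \<exists>x\<in>K. dist y x \<le> ?d)"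
    using hausdorff_dist_le_iff[of K L ?d] K L
    by (auto simp: compact_convex_sets_def dist_commute)
  then have "\<forall>p\<in>(\<lambda>x. l *\<^sub>R x) ` difference_body K. \<exists>q\<in>(\<lambda>x. l *\<^sub>R x) ` difference_body L.
      dist p q \<le> l * (2 * ?d)"
    "\<forall>p\<in>(\<lambda>x. l *\<^sub>R x) ` difference_body L. \<exists>q\<in>(\<lambda>x. l *\<^sub>R x) ` difference_body K.
      dist q p \<le> l * (2 * ?d)"
    using near[of K L ?d] near[of L K ?d] by (auto simp: dist_commute)
  moreover have "(\<lambda>x. l *\<^sub>R x) ` difference_body A \<in> compact_convex_sets"
    if "A \<in> compact_convex_sets" for A :: "'a set"
    using that
    by (intro compact_convex_sets_linear_image compact_convex_sets_difference_body) simp_all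
  ultimately show ?thesis
    using K L by (subst hausdorff_dist_le_iff) (simp_all add: compact_convex_sets_def)
qed

text \<open>A point of \<open>S\<close> outside \<open>T\<close> would be strictly separated from
  \<open>T\<close> by a hyperplane, and the inner product with its unit normal would take a value at
  that point that it takes nowhere on \<open>T\<close>.\<close>

lemma closed_convex_subset_of_inner_images:
  fixes S T :: "'a::euclidean_space set"
  assumes T: "closed T" "convex T"
    and sub: "\<And>u. norm u = 1 \<Longrightarrow> (\<bullet>) u ` S \<subseteq> (\<bullet>) u ` T"
  shows "S \<subseteq> T"
proof
  fix z assume z: "z \<in> S"
  obtain e :: 'a where e: "norm e = 1" using vector_choose_size[of 1] by auto
  show "z \<in> T"
  proof (rule ccontr)
    assume "z \<notin> T"
    with T obtain a b where ab: "a \<bullet> z < b" "\<forall>x\<in>T. a \<bullet> x > b"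
      using separating_hyperplane_closed_point by blast
    \<comment> \<open>The hypothesis concerns unit vectors, so \<open>a\<close> is normalised.
      Separation from an empty \<open>T\<close> may yield \<open>a = 0\<close>; then any unit vector
      keeps \<open>a = norm a *\<^sub>R u\<close> true.\<close>
    define u where "u = (if a = 0 then e else sgn a)"
    have u: "norm u = 1" "a = norm a *\<^sub>R u"
      using e by (auto simp: u_def norm_sgn sgn_div_norm)
    obtain y where "y \<in> T" "u \<bullet> z = u \<bullet> y"
      using sub[OF u(1)] z by blast
    then have "a \<bullet> z = a \<bullet> y" "a \<bullet> y > b"
      using u(2) ab by (metis inner_scaleR_left, blast)
    with ab show False by simp
  qed
qed

section \<open>Covariant symmetrizations\<close>

text \<open>An injective linear endomorphism of a finite-dimensional space has an invertible matrix,
  so covariance becomes available for maps instead of matrices.\<close>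

lemma GL_covariant_inj:
  fixes F :: "(real ^ 'n) set \<Rightarrow> (real ^ 'n) set"
  assumes "GL_covariant F" "linear f" "inj f" "K \<in> compact_convex_sets"
  shows "F (f ` K) = f ` F K"
proof -
  have f: "(\<lambda>x. matrix f *v x) = f"
    using matrix_vector_mul(2)[OF assms(2)] by simp
  then have "invertible (matrix f)"
    using assms(3) by (simp add: invertible_left_inverse matrix_left_invertible_injective)
  then show ?thesis
    using assms(1,4) f unfolding GL_covariant_def by metis
qed

text \<open>A positive semidefinite map \<open>f\<close> is the limit of the injective maps \<open>f + \<epsilon> id\<close>.\<close>

lemma GL_covariant_psd:
  fixes F :: "(real ^ 'n) set \<Rightarrow> (real ^ 'n) set"
  assumes cont: "hausdorff_continuous F" and GL: "GL_covariant F"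
    and F: "F \<in> compact_convex_sets \<rightarrow> compact_convex_sets"
    and f: "linear f" and psd: "\<And>x. 0 \<le> x \<bullet> f x" and K: "K \<in> compact_convex_sets"
  shows "F (f ` K) = f ` F K"
proof -
  \<comment> \<open>\<open>Suc\<close> keeps the coefficient positive for all \<open>m\<close>: with
    \<open>inverse 0 = 0\<close> the first map would be \<open>f\<close> itself, which need not be
    injective.\<close>
  define g where "g m x = f x + inverse (real (Suc m)) *\<^sub>R x" for m x
  have lin: "linear (g m)" for m
    unfolding g_def
    by (intro linear_compose_add f linear_compose_scale_right linear_ident)
  have inj: "inj (g m)" for m
    unfolding linear_injective_0[OF lin]
  proof (intro allI impI)
    \<comment> \<open>Pairing with \<open>x\<close> gives a vanishing sum of two nonnegative terms,
      so the term with \<open>x \<bullet> x\<close> is zero.\<close>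
    fix x assume "g m x = 0"
    then have "x \<bullet> f x + inverse (real (Suc m)) * (x \<bullet> x) = 0"
      unfolding g_def by (metis inner_add_right inner_scaleR_right inner_zero_right)
    moreover have "0 \<le> inverse (real (Suc m)) * (x \<bullet> x)" by simp
    ultimately have "inverse (real (Suc m)) * (x \<bullet> x) = 0"
      using psd[of x] by linarith
    then show "x = 0" by simp
  qed
  have cc: "compact S" "S \<noteq> {}" if "S \<in> compact_convex_sets" for S :: "(real ^ 'n) set"
    using that by (auto simp: compact_convex_sets_def)
  note img = compact_convex_sets_linear_image
  \<comment> \<open>A bounded set lies in a ball of radius \<open>R\<close>, where
    \<open>g m\<close> and \<open>f\<close> differ by at most \<open>R\<close> times the
    coefficient.\<close>
  have lim: "(\<lambda>m. hausdorff_dist (g m ` S) (f ` S)) \<longlonglongrightarrow> 0" if S: "S \<in> compact_convex_sets" for S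
  proof -
    obtain R where R: "\<And>x. x \<in> S \<Longrightarrow> norm x \<le> R"
      using compact_imp_bounded[OF cc(1)[OF S]] bounded_iff by blast
    have le: "hausdorff_dist (g m ` S) (f ` S) \<le> inverse (real (Suc m)) * R" for m
      using R cc img[OF lin S] img[OF f S] S
      by (intro hausdorff_dist_image_le) (auto simp: g_def dist_norm intro!: mult_left_mono)
    have tends: "(\<lambda>m. inverse (real (Suc m)) * R) \<longlonglongrightarrow> 0"
      using tendsto_mult_left_zero[OF LIMSEQ_inverse_real_of_nat] by simp
    have nonneg: "0 \<le> hausdorff_dist (g m ` S) (f ` S)" for m
      by (intro hausdorff_dist_nonneg cc img lin f S)
    show ?thesis
      by (rule tendsto_sandwich[OF _ _ tendsto_const tends]; intro always_eventually allI nonneg le)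
  qed
  have FK: "F K \<in> compact_convex_sets" "F (f ` K) \<in> compact_convex_sets"
    using F K img[OF f K] by auto
  \<comment> \<open>By continuity and covariance, the images of \<open>F K\<close> under
    \<open>g m\<close> converge to the value of \<open>F\<close> at the image of \<open>K\<close>
    under \<open>f\<close>. By \<open>lim\<close> they also converge to the image of
    \<open>F K\<close> under \<open>f\<close>, and the triangle inequality identifies the two
    limits.\<close>
  have "(\<lambda>m. hausdorff_dist (F (g m ` K)) (F (f ` K))) \<longlonglongrightarrow> 0"
    by (rule cont[unfolded hausdorff_continuous_def, rule_format, OF img[OF lin K] img[OF f K]
      lim[OF K]])
  then have "(\<lambda>m. hausdorff_dist (F (f ` K)) (g m ` F K)) \<longlonglongrightarrow> 0"
    by (simp add: GL_covariant_inj[OF GL lin inj K] hausdorff_dist_commute)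
  from tendsto_add[OF this lim[OF FK(1)]]
  have "(\<lambda>m. hausdorff_dist (F (f ` K)) (g m ` F K) + hausdorff_dist (g m ` F K) (f ` F K))
      \<longlonglongrightarrow> 0" by simp
  then have "hausdorff_dist (F (f ` K)) (f ` F K) \<le> 0"
    by (rule LIMSEQ_le_const) (intro exI allI impI
      hausdorff_dist_triangle[OF cc[OF FK(2)] cc[OF img[OF lin FK(1)]] cc[OF img[OF f FK(1)]]])
  then show ?thesis
    by (rule hausdorff_dist_le_0_imp_eq[OF cc[OF FK(2)] cc[OF img[OF f FK(1)]]])
qed

section \<open>Projections onto lines and the values at segments\<close>

lemma inner_image_interval:
  assumes "K \<in> compact_convex_sets"
  obtains a b :: real where "a \<le> b" "(\<bullet>) u ` K = {a..b}"
proof -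
  have "(\<bullet>) u ` K \<in> compact_convex_sets"
    using assms bounded_linear_inner_right
    by (intro compact_convex_sets_linear_image bounded_linear.linear)
  then have "(\<bullet>) u ` K \<noteq> {}" "connected ((\<bullet>) u ` K)" "compact ((\<bullet>) u ` K)"
    by (auto simp: compact_convex_sets_def convex_connected)
  then obtain a b where ab: "(\<bullet>) u ` K = {a..b}" "{a..b} \<noteq> {}"
    using connected_compact_interval_1[of "(\<bullet>) u ` K"] by metis
  from ab(2) have "a \<le> b" by simp
  then show ?thesis using ab(1) by (rule that)
qed

lemma segment_in_compact_convex_sets:
  fixes v :: "'a::euclidean_space"
  assumes "a \<le> b"
  shows "(\<lambda>t. t *\<^sub>R v) ` {a..b} \<in> compact_convex_sets"
  using assms
  by (intro compact_convex_sets_linear_image linear_scaleR_left) (auto simp: compact_convex_sets_def)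

text \<open>For a unit vector \<open>u\<close> the map on the left is the orthogonal projection onto
  the line of \<open>u\<close>. Projections are thereby computed from intervals of inner
  products.\<close>

lemma image_inner_scaleR:
  "(\<lambda>x. (u \<bullet> x) *\<^sub>R u) ` K = (\<lambda>t. t *\<^sub>R u) ` ((\<bullet>) u ` K)"
  by (simp add: image_image)

text \<open>Orthogonal maps carry any unit vector to any other and homotheties adjust the length, so
  the value at a single unit segment fixes one \<open>l\<close> for all directions and
  lengths.\<close>

lemma covariant_symmetrization_segment:
  fixes F :: "(real ^ 'n) set \<Rightarrow> (real ^ 'n) set"
  assumes cont: "hausdorff_continuous F" and GL: "GL_covariant F"
    and F: "F \<in> compact_convex_sets \<rightarrow> symmetric_compact_convex_sets"
  obtains l where "l \<ge> 0"
    "\<And>u w. norm u = 1 \<Longrightarrow> 0 \<le> w \<Longrightarrow>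
      F ((\<lambda>t. t *\<^sub>R u) ` {0..w}) = (\<lambda>t. t *\<^sub>R u) ` {-(l * w)..l * w}"
proof -
  have F': "F \<in> compact_convex_sets \<rightarrow> compact_convex_sets"
    using F by (auto simp: symmetric_compact_convex_sets_def)
  note psd = GL_covariant_psd[OF cont GL F']
  obtain e :: "real ^ 'n" where e: "norm e = 1" using vector_choose_size[of 1] by auto
  then have ee: "e \<bullet> e = 1" by (simp add: norm_eq_1)
  define E where "E = (\<lambda>t. t *\<^sub>R e) ` {0..1::real}"
  have E: "E \<in> compact_convex_sets" unfolding E_def by (rule segment_in_compact_convex_sets) simp
  obtain a l where al: "a \<le> l" "(\<bullet>) e ` F E = {a..l}"
    using inner_image_interval F' E by blast
  \<comment> \<open>The projection onto the line of \<open>e\<close> fixes \<open>E\<close>. It is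
    positive semidefinite, since pairing its value at \<open>x\<close> with \<open>x\<close> gives
    the square of \<open>e \<bullet> x\<close>. Hence it maps \<open>F E\<close> onto itself, and
    \<open>F E\<close> lies on that line.\<close>
  have "(\<lambda>x. (e \<bullet> x) *\<^sub>R e) ` E = E" unfolding E_def by (simp add: image_image ee)
  moreover have "F ((\<lambda>x. (e \<bullet> x) *\<^sub>R e) ` E) = (\<lambda>x. (e \<bullet> x) *\<^sub>R e) ` F E"
    by (rule psd[OF _ _ E])
      (auto intro!: linearI simp: inner_add_right algebra_simps inner_commute)
  ultimately have FE: "F E = (\<lambda>t. t *\<^sub>R e) ` {a..l}"
    using image_inner_scaleR[of e "F E"] al by simp
  \<comment> \<open>Symmetry in the origin passes to the interval of inner products, which must
    equal its own reflection; this forces \<open>a = - l\<close>.\<close>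
  have "F E = uminus ` F E"
    using F E by (auto simp: symmetric_compact_convex_sets_def o_symmetric_def)
  then have "(\<bullet>) e ` F E = (\<bullet>) e ` uminus ` F E"
    by (rule arg_cong)
  also have "\<dots> = uminus ` ((\<bullet>) e ` F E)"
    by (simp add: image_image)
  finally have "(\<bullet>) e ` F E = uminus ` ((\<bullet>) e ` F E)" .
  then have "{a..l} = {-l..-a}" using al(2) by simp
  then have a: "a = - l" using al(1) unfolding Icc_eq_Icc by linarith
  show ?thesis
  proof (rule that)
    show "l \<ge> 0" using al a by simp
  next
    fix u :: "real ^ 'n" and w :: real
    assume u: "norm u = 1" and w: "0 \<le> w"
    obtain r where r: "orthogonal_transformation r" "r e = u"
      using orthogonal_transformation_exists_1[OF e u] by auto
    have lr: "linear r" and ir: "inj r"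
      using r(1) orthogonal_transformation_linear orthogonal_transformation_inj by blast+
    have re: "r (t *\<^sub>R e) = t *\<^sub>R u" for t using r(2) lr by (simp add: linear_cmul)
    have scale: "(\<lambda>t. w * t) ` {c..d} = {w * c..w * d}" if "c \<le> d" for c d
      using w that by (simp add: image_mult_atLeastAtMost_if)
    have seg: "(\<lambda>x. w *\<^sub>R x) ` r ` (\<lambda>t. t *\<^sub>R e) ` {c..d} = (\<lambda>t. t *\<^sub>R u) ` {w * c..w * d}"
      if "c \<le> d" for c d
      unfolding scale[OF that, symmetric] by (simp add: image_image re)
    have "F ((\<lambda>t. t *\<^sub>R u) ` {0..w}) = F ((\<lambda>x. w *\<^sub>R x) ` r ` E)"
      using seg[of 0 1] by (simp add: E_def)
    also have "\<dots> = (\<lambda>x. w *\<^sub>R x) ` F (r ` E)"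
      \<comment> \<open>For \<open>w = 0\<close> the homothety is not injective, so the positive
        semidefinite form of covariance is used here.\<close>
      using w by (intro psd compact_convex_sets_linear_image[OF lr E]) simp_all
    also have "\<dots> = (\<lambda>x. w *\<^sub>R x) ` r ` F E"
      by (simp add: GL_covariant_inj[OF GL lr ir E])
    also have "\<dots> = (\<lambda>t. t *\<^sub>R u) ` {-(l * w)..l * w}"
      using seg[OF al(1)] by (simp add: FE a mult.commute)
    finally show "F ((\<lambda>t. t *\<^sub>R u) ` {0..w}) = (\<lambda>t. t *\<^sub>R u) ` {-(l * w)..l * w}" .
  qed
qed

section \<open>From segments to all compact convex sets\<close>

lemma covariant_symmetrization_eq_difference_body:
  fixes F :: "(real ^ 'n) set \<Rightarrow> (real ^ 'n) set"
  assumes cont: "hausdorff_continuous F" and GL: "GL_covariant F" and tr: "translation_invariant F"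
    and F: "F \<in> compact_convex_sets \<rightarrow> symmetric_compact_convex_sets"
  shows "\<exists>l\<ge>0. \<forall>K\<in>compact_convex_sets. F K = (\<lambda>x. l *\<^sub>R x) ` difference_body K"
proof -
  have F': "F \<in> compact_convex_sets \<rightarrow> compact_convex_sets"
    using F by (auto simp: symmetric_compact_convex_sets_def)
  obtain l where l: "l \<ge> 0" and seg: "\<And>u w. norm u = 1 \<Longrightarrow> 0 \<le> w \<Longrightarrow>
      F ((\<lambda>t. t *\<^sub>R u) ` {0..w}) = (\<lambda>t. t *\<^sub>R u) ` {-(l * w)..l * w}"
    using covariant_symmetrization_segment[OF cont GL F] by blast
  have scale: "{-(l * w)..l * w} = (\<lambda>t. l * t) ` {-w..w}" if "0 \<le> w" for w
    using that l by (simp add: image_mult_atLeastAtMost_if)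
  show ?thesis
  proof (intro exI conjI ballI, rule l)
    fix K :: "(real ^ 'n) set" assume K: "K \<in> compact_convex_sets"
    define D where "D = (\<lambda>x. l *\<^sub>R x) ` difference_body K"
    have D: "D \<in> compact_convex_sets" unfolding D_def
      by (intro compact_convex_sets_linear_image compact_convex_sets_difference_body K) simp_all
    have FK: "F K \<in> compact_convex_sets" using F' K by auto
    have eq: "(\<bullet>) u ` F K = (\<bullet>) u ` D" if u: "norm u = 1" for u
    proof -
      let ?P = "\<lambda>x. (u \<bullet> x) *\<^sub>R u"
      let ?T = "\<lambda>t. t *\<^sub>R u"
      have P: "linear ?P" by (auto intro!: linearI simp: inner_add_right algebra_simps)
      obtain a b where ab: "a \<le> b" "(\<bullet>) u ` K = {a..b}" using inner_image_interval[OF K] .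
      have PK: "?P ` K = ?T ` {a..b}" unfolding image_inner_scaleR ab(2) ..
      \<comment> \<open>Shifting the segment to start at the origin makes \<open>seg\<close>
        applicable with \<open>w = b - a\<close>; translation invariance absorbs the shift.\<close>
      also have "{a..b} = (\<lambda>t. t + a) ` {0..b - a}" using ab(1) by simp
      also have "?T ` \<dots> = (\<lambda>x. x + a *\<^sub>R u) ` ?T ` {0..b - a}"
        by (simp only: image_image scaleR_add_left)
      finally have "F (?P ` K) = F (?T ` {0..b - a})"
        using tr segment_in_compact_convex_sets[of 0 "b - a" u] ab(1)
        unfolding translation_invariant_def by simp
      also have "\<dots> = ?T ` {-(l * (b - a))..l * (b - a)}"
        using seg[OF u, of "b - a"] ab(1) by simp
      \<comment> \<open>With the factor \<open>l\<close> pulled out, what remains is the difference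
        body of the projection of \<open>K\<close>, a segment of length
        \<open>b - a\<close>.\<close>
      also have "{-(l * (b - a))..l * (b - a)} = (\<lambda>t. l * t) ` {-(b - a)..b - a}"
        using scale ab(1) by simp
      also have "?T ` \<dots> = (\<lambda>x. l *\<^sub>R x) ` difference_body (?P ` K)"
        unfolding PK difference_body_segment[OF ab(1)] by (simp add: image_image)
      also have "\<dots> = ?P ` D"
        unfolding difference_body_linear_image[OF P] D_def
        by (simp add: image_image)
      finally have "?P ` F K = ?P ` D"
        using GL_covariant_psd[OF cont GL F' P _ K] by (simp add: inner_commute)
      \<comment> \<open>Since \<open>u \<bullet> u = 1\<close>, the inner product with
        \<open>u\<close> is unchanged by the projection \<open>?P\<close>.\<close>
      then have "(\<bullet>) u ` ?P ` F K = (\<bullet>) u ` ?P ` D" by simp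
      moreover have "u \<bullet> u = 1" using u by (simp add: norm_eq_1)
      ultimately show ?thesis by (simp add: image_image)
    qed
    have "F K = D"
      using closed_convex_subset_of_inner_images[of D "F K"]
        closed_convex_subset_of_inner_images[of "F K" D] D FK eq
      by (auto simp: compact_convex_sets_def compact_imp_closed)
    then show "F K = (\<lambda>x. l *\<^sub>R x) ` difference_body K" by (simp add: D_def)
  qed
qed

section \<open>Properties of the scaled difference body\<close>

lemma scaled_difference_body_symmetrization:
  fixes F :: "(real ^ 'n) set \<Rightarrow> (real ^ 'n) set"
  assumes l: "l \<ge> 0"
    and F: "\<And>K. K \<in> compact_convex_sets \<Longrightarrow> F K = (\<lambda>x. l *\<^sub>R x) ` difference_body K"
  shows "hausdorff_continuous F" "GL_covariant F" "translation_invariant F"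
proof -
  show "hausdorff_continuous F"
    unfolding hausdorff_continuous_def
  proof (intro allI impI)
    fix Ks :: "nat \<Rightarrow> (real ^ 'n) set" and K
    assume Ks: "\<forall>m. Ks m \<in> compact_convex_sets" and K: "K \<in> compact_convex_sets"
      and lim: "(\<lambda>m. hausdorff_dist (Ks m) K) \<longlonglongrightarrow> 0"
    have "F S \<in> compact_convex_sets" if "S \<in> compact_convex_sets" for S
      unfolding F[OF that]
      by (intro compact_convex_sets_linear_image compact_convex_sets_difference_body that) simp_all
    then have nonneg: "0 \<le> hausdorff_dist (F (Ks m)) (F K)" for m
      using Ks K by (intro hausdorff_dist_nonneg) (auto simp: compact_convex_sets_def)
    have le: "hausdorff_dist (F (Ks m)) (F K) \<le> l * (2 * hausdorff_dist (Ks m) K)" for m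
      using hausdorff_dist_difference_body_le[OF _ K l] Ks K F by simp
    \<comment> \<open>The Lipschitz bound tends to 0 and squeezes the distances of the
      values.\<close>
    have tends: "(\<lambda>m. l * (2 * hausdorff_dist (Ks m) K)) \<longlonglongrightarrow> 0"
      using lim by (intro tendsto_mult_right_zero)
    show "(\<lambda>m. hausdorff_dist (F (Ks m)) (F K)) \<longlonglongrightarrow> 0"
      by (rule tendsto_sandwich[OF _ _ tendsto_const tends]; intro always_eventually allI nonneg le)
  qed
  show "GL_covariant F"
    unfolding GL_covariant_def
  proof (intro allI impI ballI)
    fix A :: "real ^ 'n ^ 'n" and K :: "(real ^ 'n) set"
    assume K: "K \<in> compact_convex_sets"
    note A = matrix_vector_mul_linear[of A]
    show "(\<lambda>x. A *v x) ` F K = F ((\<lambda>x. A *v x) ` K)"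
      unfolding F[OF K] F[OF compact_convex_sets_linear_image[OF A K]]
        difference_body_linear_image[OF A]
      by (simp add: image_image linear_cmul[OF A])
  qed
  show "translation_invariant F"
    unfolding translation_invariant_def
  proof (intro ballI allI)
    fix K :: "(real ^ 'n) set" and z
    assume K: "K \<in> compact_convex_sets"
    \<comment> \<open>The formula for \<open>F\<close> is known only on compact convex sets, so the
      translate must first be shown to be one.\<close>
    then have "(\<lambda>x. x + z) ` K \<in> compact_convex_sets"
      using compact_translation[of K z] convex_translation[of K z]
      by (simp add: compact_convex_sets_def add.commute)
    then show "F ((\<lambda>x. x + z) ` K) = F K"
      by (simp add: F K difference_body_translation)
  qed
qed

theorem theoremD:
  fixes F :: "(real ^ 'n) set \<Rightarrow> (real ^ 'n) set"
  assumes "CARD('n) \<ge> 2"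
    and "F \<in> compact_convex_sets \<rightarrow> symmetric_compact_convex_sets"
  shows "hausdorff_continuous F \<and> GL_covariant F \<and> translation_invariant F \<longleftrightarrow>
    (\<exists>l::real. l \<ge> 0 \<and>
      (\<forall>K \<in> compact_convex_sets. F K = (\<lambda>x. l *\<^sub>R x) ` difference_body K))"
  using covariant_symmetrization_eq_difference_body[OF _ _ _ assms(2)]
    scaled_difference_body_symmetrization[of _ F]
  by (intro iffI) auto

end
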